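(* Let $m,n\ge0$ be integers with $m\ne n$, and put $a:=\min(m,n)$, $d:=|m-n|$. Then $$\operatorname{cont}(W_n-W_m)=2^{3+\nu_2(d)}\prod_{\substack{p\ \text{odd prime}\\ p-1\mid 2d}}p^{\min(2a+1,\;1+\nu_p(d))}.$$
   Context: Put $T_k=k(k+1)/2$. For $n\ge0$, let $N_n(q):=\sum_{k\ge0}(-1)^{T_k}(2k+1)^{2n+1}q^{T_k}$, $D:=N_0$, and $W_n:=N_n/D$, regarded as formal power series; since $D(0)=1$, $W_n\in\mathbb Z[[q]]$. For a nonzero series $F\in\mathbb Z[[q]]$, $\operatorname{cont}(F)$ denotes the positive generator of the ideal of $\mathbb Z$ generated by its coefficients. $\nu_p$ is the normalized $p$-adic valuation. *)

theory Defs
  imports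
    "HOL-Computational_Algebra.Formal_Power_Series"
    "HOL-Computational_Algebra.Group_Closure"
    "HOL-Algebra.IntRing"
begin

unbundle fps_syntax

definition tri :: "nat \<Rightarrow> nat" where
  "tri k = k * (k + 1) div 2"

text \<open>
  The infinite sum is taken in the \<open>X\<close>-adic topology of the library; it converges, see
  \<open>N_series_sums\<close> below.
\<close>

definition N_series :: "nat \<Rightarrow> int fps" where
  "N_series n = (\<Sum>k. fps_const ((-1) ^ tri k * (2 * int k + 1) ^ (2 * n + 1)) * fps_X ^ tri k)"

definition D_series :: "int fps" where
  "D_series = N_series 0"

text \<open>
  The library's division of power series needs an inverse on the coefficients, which \<^typ>\<open>int\<close>
  does not have. Since \<open>D_series\<close> has constant coefficient 1, it is inverted with
  \<open>fps_right_inverse\<close>, whose second argument is the inverse of the constant coefficient; see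
  \<open>W_series_mult_D_series\<close> below.
\<close>

definition W_series :: "nat \<Rightarrow> int fps" where
  "W_series n = N_series n * fps_right_inverse D_series 1"

text \<open>
  \<open>Idl\<^bsub>\<Z>\<^esub> S\<close> is the ideal of the ring of integers generated by \<open>S\<close>. The zero series has no positive
  generator; its content is set to 0, so that \<open>cont F > 0\<close> entails \<open>F \<noteq> 0\<close>.
\<close>

definition cont :: "int fps \<Rightarrow> int" where
  "cont F = (if F = 0 then 0
     else (THE c. c > 0 \<and> Idl\<^bsub>\<Z>\<^esub> {c} = Idl\<^bsub>\<Z>\<^esub> (range (\<lambda>i. F $ i))))"

lemma tri_Suc: "tri (Suc k) = tri k + Suc k"
proof -
  have "Suc k * (Suc k + 1) = k * (k + 1) + 2 * Suc k" by (simp add: algebra_simps)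
  then show ?thesis unfolding tri_def by (simp only: div_mult_self4 [symmetric]) simp
qed

lemma tri_ge: "k \<le> tri k"
  by (induction k) (simp_all add: tri_Suc)

lemma N_series_sums:
  "(\<lambda>k. fps_const ((-1) ^ tri k * (2 * int k + 1) ^ (2 * n + 1)) * fps_X ^ tri k) sums N_series n"
proof -
  let ?f = "\<lambda>k. fps_const ((-1) ^ tri k * (2 * int k + 1) ^ (2 * n + 1)) * fps_X ^ tri k"
  have "(\<lambda>m. \<Sum>k<m. ?f k) \<longlonglongrightarrow> Abs_fps (\<lambda>i. (\<Sum>k\<le>i. ?f k) $ i)"
  proof (rule tendsto_fpsI)
    fix i
    have "(\<Sum>k<m. ?f k) $ i = (\<Sum>k\<le>i. ?f k) $ i" if "m > i" for m
    proof -
      have "(\<Sum>k<m. ?f k $ i) = (\<Sum>k\<le>i. ?f k $ i)"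
      proof (rule sum.mono_neutral_right)
        show "\<forall>k\<in>{..<m} - {..i}. ?f k $ i = 0"
        proof
          fix k assume "k \<in> {..<m} - {..i}"
          then have "i < tri k" using tri_ge [of k] by simp
          then show "?f k $ i = 0" by (simp add: fps_X_power_nth)
        qed
      qed (use that in auto)
      then show ?thesis by (simp add: fps_sum_nth)
    qed
    then show "\<forall>\<^sub>F m in sequentially.
        (\<Sum>k<m. ?f k) $ i = Abs_fps (\<lambda>i. (\<Sum>k\<le>i. ?f k) $ i) $ i"
      by (auto intro: eventually_mono [OF eventually_gt_at_top [of i]])
  qed
  then have "summable ?f" by (auto simp: summable_def sums_def)
  then show ?thesis unfolding N_series_def by (rule summable_sums)
qed

lemma N_series_nth:
  "N_series n $ i =
     (\<Sum>k | tri k = i. (-1) ^ tri k * (2 * int k + 1) ^ (2 * n + 1))"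
proof -
  let ?c = "\<lambda>k. (-1) ^ tri k * (2 * int k + 1) ^ (2 * n + 1)"
  let ?f = "\<lambda>k. fps_const (?c k) * fps_X ^ tri k"
  have "\<forall>\<^sub>F m in sequentially. (\<Sum>k<m. ?f k) $ i = N_series n $ i"
    using N_series_sums [of n] unfolding sums_def tendsto_fps_iff by blast
  then obtain M where M: "\<And>m. m \<ge> M \<Longrightarrow> (\<Sum>k<m. ?f k) $ i = N_series n $ i"
    by (auto simp: eventually_sequentially)
  define m where "m = max M (Suc i)"
  have "N_series n $ i = (\<Sum>k<m. ?f k $ i)"
    using M [of m] by (simp add: m_def fps_sum_nth)
  also have "\<dots> = (\<Sum>k<m. if tri k = i then ?c k else 0)"
    by (rule sum.cong) (auto simp: fps_X_power_nth)
  also have "\<dots> = (\<Sum>k\<in>{k. tri k = i}. ?c k)"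
  proof (rule sum.mono_neutral_cong_right)
    show "{k. tri k = i} \<subseteq> {..<m}"
      using tri_ge by (auto simp: m_def less_Suc_eq_le le_max_iff_disj less_max_iff_disj)
  qed auto
  finally show ?thesis .
qed

lemma D_series_nth_0: "D_series $ 0 = 1"
proof -
  have "{k. tri k = 0} = {0}"
  proof (intro equalityI subsetI)
    fix k assume "k \<in> {k. tri k = 0}"
    then show "k \<in> {0}" using tri_ge [of k] by simp
  qed (simp add: tri_def)
  then show ?thesis by (simp add: D_series_def N_series_nth tri_def)
qed

lemma W_series_mult_D_series: "W_series n * D_series = N_series n"
proof -
  have "D_series * fps_right_inverse D_series 1 = 1"
    by (rule fps_right_inverse) (simp add: D_series_nth_0)
  then show ?thesis by (simp add: W_series_def mult.assoc mult.commute)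
qed

lemma Idl_int_eq_Gcd: "Idl\<^bsub>\<Z>\<^esub> S = Idl\<^bsub>\<Z>\<^esub> {Gcd S}" for S :: "int set"
proof
  have "S \<subseteq> Idl\<^bsub>\<Z>\<^esub> {Gcd S}"
  proof
    fix s assume "s \<in> S"
    then have "Gcd S dvd s" by (rule Gcd_dvd)
    then show "s \<in> Idl\<^bsub>\<Z>\<^esub> {Gcd S}" by (auto simp: int_Idl dvd_def)
  qed
  then show "Idl\<^bsub>\<Z>\<^esub> S \<subseteq> Idl\<^bsub>\<Z>\<^esub> {Gcd S}"
    by (intro int.genideal_minimal int.genideal_ideal) simp_all
next
  interpret I: ideal "Idl\<^bsub>\<Z>\<^esub> S" \<Z>
    by (rule int.genideal_ideal) simp
  have "x \<in> Idl\<^bsub>\<Z>\<^esub> S" if "x \<in> group_closure S" for x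
    using that
  proof induction
    case (base s)
    then show ?case
      using I.zero_closed int.genideal_self [of S] by (auto simp: int_zero_eq)
  next
    case (diff s t)
    have "- t \<in> Idl\<^bsub>\<Z>\<^esub> S"
      using I.I_l_closed [OF diff.IH(2), of "- 1"] by simp
    then show ?case
      using I.a_closed [OF diff.IH(1), of "- t"] by simp
  qed
  then have "{Gcd S} \<subseteq> Idl\<^bsub>\<Z>\<^esub> S" using Gcd_in_group_closure [of S] by blast
  then show "Idl\<^bsub>\<Z>\<^esub> {Gcd S} \<subseteq> Idl\<^bsub>\<Z>\<^esub> S"
    by (intro int.genideal_minimal I.is_ideal)
qed

lemma cont_eq_Gcd: "cont F = Gcd (range (\<lambda>i. F $ i))"
proof (cases "F = 0")
  case False
  let ?G = "Gcd (range (\<lambda>i. F $ i))"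
  have "?G \<noteq> 0" using False by (auto simp: Gcd_0_iff fps_eq_iff)
  then have "?G > 0" using Gcd_int_greater_eq_0 [of "range (\<lambda>i. F $ i)"] by linarith
  then show ?thesis using False
    unfolding cont_def Idl_int_eq_Gcd [of "range (\<lambda>i. F $ i)"] Idl_eq_abs
    by (auto intro!: the_equality)
qed (simp add: cont_def)

unbundle no fps_syntax

end

theory Submission
  imports Defs "HOL-Number_Theory.Residue_Primitive_Roots"
begin

unbundle fps_syntax

text \<open>
  Multiplication by the unit \<open>D_series\<close> does not change contents (\<open>cont_mult_unit\<close>), so the content
  of \<open>W_series n - W_series m\<close> is that of \<open>N_series n - N_series m\<close>. Triangular numbers are
  pairwise distinct, hence no two summands of these series share an exponent, and the content
  is simply the gcd, over all odd \<open>x > 0\<close>, of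
  \<open>x ^ (2 * n + 1) - x ^ (2 * m + 1) = \<plusminus> t x\<close>, where \<open>t x = x ^ (2 * a + 1) * (x ^ (2 * d) - 1)\<close>.

  This gcd is found one prime at a time, the tool being the lifting-the-exponent formula
  \<open>lifting_the_exponent\<close>. It suffices to find the largest power of \<open>p\<close> that divides every
  \<open>t x\<close> (\<open>prime_power_dvd_terms\<close>) and one odd \<open>x\<close> at which no higher power does
  (\<open>not_prime_power_Suc_dvd_all_terms\<close>).

  For \<open>p = 2\<close>, odd squares are 1 modulo 8, so \<open>x ^ (2 * d) - 1\<close> is divisible by
  \<open>2 ^ (3 + multiplicity 2 d)\<close>, and \<open>x = 3\<close> attains this. Let \<open>p\<close> be odd. If \<open>p - 1\<close> does not divide
  \<open>2 * d\<close>, an odd primitive root \<open>x\<close> modulo \<open>p\<close> makes \<open>t x\<close> prime to \<open>p\<close>. If it does, then a multiple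
  \<open>x\<close> of \<open>p\<close> contributes at least \<open>p ^ (2 * a + 1)\<close>, with equality for \<open>x = p\<close>, whereas for \<open>x\<close> prime to
  \<open>p\<close> Fermat's theorem and lifting the exponent give at least
  \<open>p ^ (1 + multiplicity p d)\<close>, with equality for \<open>x = 2 * p + 1\<close>. The smaller exponent wins.
\<close>

section \<open>Lifting the exponent\<close>

lemma one_plus_power_linear_approx:
  fixes c :: "'a :: comm_ring_1"
  shows "c ^ 2 dvd (1 + c) ^ i - (1 + of_nat i * c)"
proof (induction i)
  case (Suc i)
  have "(1 + c) ^ Suc i - (1 + of_nat (Suc i) * c) =
    (1 + c) * ((1 + c) ^ i - (1 + of_nat i * c)) + c ^ 2 * of_nat i"
    by (simp add: algebra_simps power2_eq_square)
  then show ?case using Suc by simp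
qed simp

text \<open>
  This is the step that gains exactly one factor \<open>p\<close>. With \<open>y = 1 + c\<close>, the linear approximation
  turns the sum into \<open>p + c * (p * (p - 1) div 2)\<close> modulo \<open>c\<^sup>2\<close>. For odd \<open>p\<close> the
  second summand vanishes modulo \<open>p\<^sup>2\<close>. For \<open>p = 2\<close> it does so only if \<open>4\<close> divides \<open>c\<close>;
  \<open>y = 3\<close>, with sum \<open>4\<close>, shows that this extra condition matters.
\<close>

lemma multiplicity_geometric_sum:
  fixes y :: int
  assumes p: "prime p" and y: "int p dvd y - 1" and y4: "p = 2 \<Longrightarrow> 4 dvd y - 1"
  shows "multiplicity (int p) (\<Sum>i<p. y ^ i) = 1"
proof -
  have "(int p)\<^sup>2 dvd (\<Sum>i<p. y ^ i) - int p"
  proof (cases "p = 2")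
    case True
    then show ?thesis using y4 by (simp add: numeral_2_eq_2)
  next
    case False
    then have "odd p" using p prime_odd_nat [of p] prime_ge_2_nat [of p] by linarith
    then obtain r where r: "p = 2 * r + 1" by (elim oddE)
    define c where "c = y - 1"
    have sum_i: "(\<Sum>i<p. int i) = int p * int r"
      unfolding r by (induction r) (simp_all add: algebra_simps)
    have "c\<^sup>2 dvd (\<Sum>i<p. (1 + c) ^ i - (1 + of_nat i * c))"
      by (intro dvd_sum one_plus_power_linear_approx)
    then have "(int p)\<^sup>2 dvd (\<Sum>i<p. y ^ i - (1 + int i * c))"
      using dvd_trans [OF dvd_power_same [OF y, of 2]] by (simp add: c_def)
    also have "(\<Sum>i<p. y ^ i - (1 + int i * c)) = (\<Sum>i<p. y ^ i) - int p - int p * c * int r"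
      by (simp add: sum_subtractf sum.distrib sum_i flip: sum_distrib_right)
    finally have "(int p)\<^sup>2 dvd (\<Sum>i<p. y ^ i) - int p - int p * c * int r" .
    moreover have "(int p)\<^sup>2 dvd int p * c * int r"
      using y by (auto simp: c_def power2_eq_square)
    ultimately show ?thesis by (metis diff_add_cancel dvd_add)
  qed
  then obtain w where "(\<Sum>i<p. y ^ i) - int p = (int p)\<^sup>2 * w" by (elim dvdE)
  then have w: "(\<Sum>i<p. y ^ i) = int p ^ 1 * (1 + int p * w)"
    by (simp add: algebra_simps power2_eq_square)
  have "\<not> int p dvd 1 + int p * w"
    using p by (simp add: dvd_add_left_iff prime_nat_iff)
  then show ?thesis
    using p by (intro multiplicity_decomposeI [OF w]) auto
qed

text \<open>
  The cofactor \<open>\<Sum>i<j. y ^ i\<close> of \<open>y - 1\<close> is congruent to \<open>j\<close> modulo \<open>p\<close>, hence prime to \<open>p\<close>.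
\<close>

lemma multiplicity_power_diff_1_coprime:
  fixes y :: int
  assumes p: "prime p" and y: "int p dvd y - 1" "y > 1" and j: "\<not> p dvd j"
  shows "multiplicity (int p) (y ^ j - 1) = multiplicity (int p) (y - 1)"
proof -
  have "[(\<Sum>i<j. y ^ i) = (\<Sum>i<j. 1 ^ i)] (mod int p)"
    using y by (intro cong_sum cong_pow) (simp add: cong_iff_dvd_diff)
  then have *: "\<not> int p dvd (\<Sum>i<j. y ^ i)"
    using j by (auto dest: cong_dvd_iff)
  then have "(\<Sum>i<j. y ^ i) \<noteq> 0" by auto
  then show ?thesis
    using p y * unfolding power_diff_1_eq [of y j]
    by (subst prime_elem_multiplicity_mult_distrib) (auto simp: not_dvd_imp_multiplicity_0)
qed

lemma multiplicity_power_prime_diff_1: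
  fixes y :: int
  assumes p: "prime p" and y: "int p dvd y - 1" "y > 1" and y4: "p = 2 \<Longrightarrow> 4 dvd y - 1"
  shows "multiplicity (int p) (y ^ p - 1) = multiplicity (int p) (y - 1) + 1"
proof -
  have "(\<Sum>i<p. y ^ i) \<noteq> 0"
    using multiplicity_geometric_sum [OF p y(1) y4] by auto
  then show ?thesis
    using p y y4 unfolding power_diff_1_eq [of y p]
    by (subst prime_elem_multiplicity_mult_distrib) (auto simp: multiplicity_geometric_sum)
qed

text \<open>
  Writing \<open>k = p ^ v * j\<close> with \<open>j\<close> prime to \<open>p\<close>, the power is taken in \<open>v\<close> steps of exponent \<open>p\<close>, each
  of which raises the multiplicity by one, and a last step of exponent \<open>j\<close>, which preserves it.
\<close>

lemma lifting_the_exponent: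
  fixes y :: int
  assumes p: "prime p" and y: "int p dvd y - 1" "y > 1" and y4: "p = 2 \<Longrightarrow> 4 dvd y - 1"
    and "k > 0"
  shows "multiplicity (int p) (y ^ k - 1) = multiplicity (int p) (y - 1) + multiplicity p k"
proof -
  define v where "v = multiplicity p k"
  have "\<not> is_unit p" using p by auto
  with \<open>k > 0\<close> obtain j where k: "k = p ^ v * j" and j: "\<not> p dvd j"
    using multiplicity_decompose' [of k p] unfolding v_def by blast
  have dvd: "y - 1 dvd y ^ i - 1" for i
    by (simp add: power_diff_1_eq)
  have gt: "y ^ i > 1" if "i > 0" for i
    using y that by (simp add: one_less_power)
  have pv: "p ^ v > 0" for v using p by (simp add: prime_gt_0_nat)
  have "multiplicity (int p) (y ^ (p ^ v) - 1) = multiplicity (int p) (y - 1) + v" for v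
  proof (induction v)
    case (Suc v)
    have "multiplicity (int p) ((y ^ (p ^ v)) ^ p - 1) =
      multiplicity (int p) (y ^ (p ^ v) - 1) + 1"
      using y(1) y4 dvd [of "p ^ v"] gt [OF pv]
      by (intro multiplicity_power_prime_diff_1 p) (auto intro: dvd_trans)
    with Suc show ?case by (simp add: mult.commute flip: power_mult)
  qed simp
  moreover have "multiplicity (int p) ((y ^ (p ^ v)) ^ j - 1) =
      multiplicity (int p) (y ^ (p ^ v) - 1)"
    using y(1) dvd [of "p ^ v"] gt [OF pv]
    by (intro multiplicity_power_diff_1_coprime p j) (auto intro: dvd_trans)
  ultimately have "multiplicity (int p) (y ^ (p ^ v * j) - 1) = multiplicity (int p) (y - 1) + v"
    by (simp add: power_mult)
  then show ?thesis unfolding k [symmetric] by (simp only: v_def)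
qed

text \<open>
  A divisibility form that also covers \<open>y = 1\<close> and \<open>k = 0\<close>, where the power minus one is 0 and
  its multiplicity carries no information.
\<close>

lemma lifting_the_exponent_dvd:
  fixes y :: int
  assumes p: "prime p" and y: "int p ^ e dvd y - 1" "y > 0" and "e > 0"
    and y4: "p = 2 \<Longrightarrow> 4 dvd y - 1"
  shows "int p ^ (e + multiplicity p k) dvd y ^ k - 1"
proof (cases "y = 1 \<or> k = 0")
  case False
  then have y1: "y > 1" using y by auto
  have "int p dvd y - 1"
    using y(1) \<open>e > 0\<close> by (meson dvd_power dvd_trans)
  moreover have "e \<le> multiplicity (int p) (y - 1)"
    using y(1) p y1 by (intro multiplicity_geI) auto
  ultimately show ?thesis
    using False p y1 y4 by (intro multiplicity_dvd') (simp add: lifting_the_exponent)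
qed auto

section \<open>The local exponents\<close>

text \<open>
  The exponent of the prime \<open>p\<close> in the gcd of the numbers
  \<open>x ^ (2 * a + 1) * (x ^ (2 * d) - 1)\<close> with \<open>x\<close> odd. There is no minimum with \<open>2 * a + 1\<close>
  at \<open>p = 2\<close> because an odd \<open>x\<close> is never divisible by 2.
\<close>

definition local_exponent :: "nat \<Rightarrow> nat \<Rightarrow> nat \<Rightarrow> nat" where
  "local_exponent a d p =
    (if p = 2 then 3 + multiplicity 2 d
     else if (p - 1) dvd 2 * d then min (2 * a + 1) (1 + multiplicity p d) else 0)"

lemma multiplicity_double:
  fixes d :: nat
  assumes "prime p" "odd p" "d > 0"
  shows "multiplicity p (2 * d) = multiplicity p d"
proof -
  have "\<not> p dvd 2" using assms by (metis dvd_refl primes_dvd_imp_eq two_is_prime_nat)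
  then show ?thesis
    using assms by (subst prime_elem_multiplicity_mult_distrib) (auto simp: not_dvd_imp_multiplicity_0)
qed

lemma odd_square_cong_1: "8 dvd int (2 * k + 1) ^ 2 - 1"
proof -
  have "int (2 * k + 1) ^ 2 - 1 = 4 * (int k * (int k + 1))"
    by (simp add: power2_eq_square algebra_simps)
  moreover have "4 * 2 dvd 4 * (int k * (int k + 1))" by (intro mult_dvd_mono) simp_all
  ultimately show ?thesis by simp
qed

lemma prime_power_dvd_terms:
  assumes p: "prime p" and d: "d > 0"
  shows "int p ^ local_exponent a d p dvd
    int (2 * k + 1) ^ (2 * a + 1) * (int (2 * k + 1) ^ (2 * d) - 1)"
proof -
  let ?x = "2 * k + 1"
  consider "p = 2" | "odd p" "(p - 1) dvd 2 * d" "p dvd ?x" | "odd p" "(p - 1) dvd 2 * d" "\<not> p dvd ?x"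
    | "p \<noteq> 2" "\<not> (p - 1) dvd 2 * d"
    using p by (metis primes_dvd_imp_eq two_is_prime_nat)
  then show ?thesis
  proof cases
    case 1
    have "4 dvd int ?x ^ 2 - 1"
      using odd_square_cong_1 [of k] by (rule dvd_trans [rotated]) simp
    then have "int p ^ (3 + multiplicity p d) dvd (int ?x ^ 2) ^ d - 1"
      using 1 odd_square_cong_1 [of k] by (intro lifting_the_exponent_dvd p) auto
    then show ?thesis
      unfolding power_mult using 1 by (intro dvd_mult) (simp add: local_exponent_def)
  next
    case 2
    then have "int p ^ (2 * a + 1) dvd int ?x ^ (2 * a + 1)"
      by (intro dvd_power_same) (simp only: int_dvd_int_iff)
    moreover have "int p ^ local_exponent a d p dvd int p ^ (2 * a + 1)"
      using 2 by (intro le_imp_power_dvd) (auto simp: local_exponent_def)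
    ultimately show ?thesis by (meson dvd_mult2 dvd_trans)
  next
    case 3
    \<comment> \<open>Fermat's theorem makes \<open>x ^ (p - 1) - 1\<close> divisible by \<open>p\<close>; the remaining exponent
      \<open>j = 2 * d div (p - 1)\<close> has the same \<open>p\<close>-part as \<open>d\<close>, since \<open>2\<close> and \<open>p - 1\<close> are prime to \<open>p\<close>.\<close>
    from 3(2) obtain j where j: "2 * d = (p - 1) * j" by (elim dvdE)
    have "j > 0" using j d by (cases j) auto
    have "multiplicity p j = multiplicity p (2 * d)"
    proof -
      have "\<not> p dvd p - 1" using p prime_gt_1_nat [OF p] by (auto dest: dvd_imp_le)
      then show ?thesis unfolding j using p \<open>j > 0\<close> prime_gt_1_nat [OF p]
        by (subst prime_elem_multiplicity_mult_distrib) (auto simp: not_dvd_imp_multiplicity_0)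
    qed
    then have mult: "multiplicity p j = multiplicity p d"
      using multiplicity_double [OF p 3(1) d] by simp
    have "[?x ^ (p - 1) = 1] (mod p)" by (rule fermat_theorem [OF p 3(3)])
    then have "[int ?x ^ (p - 1) = 1] (mod int p)"
      by (metis cong_int_iff of_nat_1 of_nat_power)
    then have "int p ^ 1 dvd int ?x ^ (p - 1) - 1"
      by (simp add: cong_iff_dvd_diff)
    then have "int p ^ (1 + multiplicity p j) dvd (int ?x ^ (p - 1)) ^ j - 1"
      using 3 by (intro lifting_the_exponent_dvd p) auto
    moreover have "int p ^ local_exponent a d p dvd int p ^ (1 + multiplicity p j)"
      using 3 unfolding mult by (intro le_imp_power_dvd) (auto simp: local_exponent_def)
    ultimately show ?thesis
      unfolding j power_mult by (meson dvd_mult dvd_trans)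
  next
    case 4
    then show ?thesis by (simp add: local_exponent_def)
  qed
qed

lemma multiplicity_coprime_times_power_diff_1:
  fixes x :: nat
  assumes p: "prime p" and "x > 1" "\<not> p dvd x" "e > 0"
  shows "multiplicity (int p) (int x ^ b * (int x ^ e - 1)) = multiplicity (int p) (int x ^ e - 1)"
proof -
  have "\<not> int p dvd int x ^ b"
    using assms prime_dvd_power [of p x b] by (metis int_dvd_int_iff of_nat_power)
  then have "multiplicity (int p) (int x ^ b) = 0" by (rule not_dvd_imp_multiplicity_0)
  moreover have "int x ^ e > 1" using assms by (intro one_less_power) auto
  then have "int x ^ e - 1 \<noteq> 0" by linarith
  moreover have "int x ^ b \<noteq> 0" using assms by simp
  moreover have "prime_elem (int p)" using p by simp
  ultimately show ?thesis by (simp add: prime_elem_multiplicity_mult_distrib del: of_nat_power)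
qed

text \<open>
  The witnesses \<open>x = 2 * k + 1\<close> are \<open>3\<close> for \<open>p = 2\<close>, an odd primitive root when \<open>p - 1\<close> does not
  divide \<open>2 * d\<close>, and otherwise \<open>p\<close> or \<open>2 * p + 1\<close>, according to which argument of the minimum is
  smaller. The number \<open>2 * p + 1\<close> is odd, and \<open>p\<close> divides \<open>2 * p + 1 - 1\<close> exactly
  once, so lifting the exponent applies to it without passing to a primitive root modulo \<open>p\<^sup>2\<close>.
\<close>

lemma not_prime_power_Suc_dvd_all_terms:
  assumes p: "prime p" and d: "d > 0"
  obtains k where "\<not> int p ^ Suc (local_exponent a d p) dvd
    int (2 * k + 1) ^ (2 * a + 1) * (int (2 * k + 1) ^ (2 * d) - 1)"
proof -
  let ?t = "\<lambda>x. int x ^ (2 * a + 1) * (int x ^ (2 * d) - 1)"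
  have nz: "?t x \<noteq> 0" if "x > 1" for x
    proof -
    have "int x ^ (2 * d) > 1" using that d by (intro one_less_power) auto
    with that show ?thesis by (simp only: mult_eq_0_iff power_eq_0_iff) simp
  qed
  have not_dvd: "\<not> int p ^ Suc (local_exponent a d p) dvd ?t x"
    if "x > 1" "multiplicity (int p) (?t x) \<le> local_exponent a d p" for x
    using nz [OF that(1)] that(2) p by (subst power_dvd_iff_le_multiplicity) auto
  have "\<exists>x. odd x \<and> \<not> int p ^ Suc (local_exponent a d p) dvd ?t x"
  proof -
    consider "p = 2" | "odd p" "(p - 1) dvd 2 * d" "a * 2 \<le> multiplicity p d"
      | "odd p" "(p - 1) dvd 2 * d" "a * 2 > multiplicity p d"
      | "odd p" "\<not> (p - 1) dvd 2 * d"
      using p by (metis not_le primes_dvd_imp_eq two_is_prime_nat)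
    then show ?thesis
    proof cases
      case 1
      have "multiplicity (int 2) (9 - 1 :: int) = 3"
        using multiplicity_decomposeI [of "8 :: int" 2 3 1] by simp
      then have "multiplicity (int p) ((3 ^ 2) ^ d - 1) = 3 + multiplicity p d"
        using lifting_the_exponent [OF p, of 9 d] 1 d by simp
      then have "multiplicity (int p) (?t 3) = local_exponent a d p"
        using multiplicity_coprime_times_power_diff_1 [OF p, of 3 "2 * d" "2 * a + 1"] 1 d
        by (simp add: local_exponent_def power_mult)
      then show ?thesis using not_dvd [of 3] by (intro exI [of _ 3]) auto
    next
      case 2
      have "\<not> int p dvd int p ^ (2 * d) - 1"
      proof
        assume "int p dvd int p ^ (2 * d) - 1"
        moreover have "int p dvd int p ^ (2 * d)" using d by (intro dvd_power) auto
        ultimately have "int p dvd 1" by (metis dvd_diff diff_diff_eq2 add_diff_cancel_left')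
        then show False using p by auto
      qed
      then have "multiplicity (int p) (?t p) = 2 * a + 1"
        using p by (intro multiplicity_decomposeI [OF refl]) auto
      then show ?thesis
        using 2 not_dvd [of p] prime_gt_1_nat [OF p] by (intro exI [of _ p]) (auto simp: local_exponent_def)
    next
      case 3
      have ndvd: "\<not> p dvd 2 * p + 1" using p by (subst dvd_add_right_iff) (auto simp: prime_nat_iff)
      have "\<not> p dvd 2" using 3 p by (metis dvd_refl primes_dvd_imp_eq two_is_prime_nat)
      then have "\<not> int p dvd 2" by (metis int_dvd_int_iff of_nat_numeral)
      then have "multiplicity (int p) (int (2 * p + 1) - 1) = 1"
        using p by (intro multiplicity_decomposeI [of _ _ _ 2]) auto
      then have "multiplicity (int p) (int (2 * p + 1) ^ (2 * d) - 1) = 1 + multiplicity p d"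
        using lifting_the_exponent [OF p, of "int (2 * p + 1)" "2 * d"] 3 p d
        by (auto simp: multiplicity_double prime_gt_0_nat)
      then have "multiplicity (int p) (?t (2 * p + 1)) = local_exponent a d p"
        using multiplicity_coprime_times_power_diff_1 [OF p _ ndvd, of "2 * d" "2 * a + 1"] 3 d
          prime_gt_0_nat [OF p]
        by (auto simp: local_exponent_def)
      then show ?thesis
        using not_dvd [of "2 * p + 1"] prime_gt_0_nat [OF p] by (intro exI [of _ "2 * p + 1"]) auto
    next
      case 4
      obtain g where g: "residue_primroot p g"
        using prime_primitive_root_exists [of p] p prime_gt_1_nat by blast
      \<comment> \<open>Adding the odd number \<open>p\<close> corrects the parity within the residue class.\<close>
      define x where "x = (if odd g then g else g + p)"
      have "odd x" using 4 by (auto simp: x_def)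
      have "[x = g] (mod p)" by (simp add: x_def cong_def)
      then have x: "residue_primroot p x" using g residue_primroot_cong by blast
      then have "\<not> [x ^ (2 * d) = 1] (mod p)"
        using 4 p unfolding residue_primroot_def ord_divides by (simp add: totient_prime)
      then have "\<not> [int x ^ (2 * d) = 1] (mod int p)"
        by (metis cong_int_iff of_nat_1 of_nat_power)
      moreover have "\<not> int p dvd int x ^ (2 * a + 1)"
        using x p unfolding residue_primroot_def
        by (metis coprime_absorb_left int_dvd_int_iff not_prime_unit of_nat_power prime_dvd_power)
      ultimately have "\<not> int p dvd ?t x"
        using p by (subst prime_dvd_mult_iff) (auto simp: cong_iff_dvd_diff)
      with \<open>odd x\<close> show ?thesis using 4 by (intro exI [of _ x]) (auto simp: local_exponent_def)
    qed
  qed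
  with that show ?thesis by (auto elim!: oddE)
qed

section \<open>Contents of power series\<close>

lemma cont_nonneg: "cont F \<ge> 0"
  by (simp add: cont_eq_Gcd Gcd_int_greater_eq_0)

lemma dvd_cont_iff: "c dvd cont F \<longleftrightarrow> (\<forall>i. c dvd F $ i)"
  unfolding cont_eq_Gcd by (auto intro: Gcd_greatest dest: dvd_trans [OF _ Gcd_dvd])

lemma cont_dvd_cont_mult: "cont F dvd cont (F * G)"
proof -
  have "cont F dvd F $ i" for i
    using dvd_cont_iff [of "cont F" F] by simp
  then show ?thesis unfolding dvd_cont_iff fps_mult_nth by (intro allI dvd_sum dvd_mult2)
qed

text \<open>
  Multiplication can only enlarge the content in the sense of divisibility; multiplying by the
  inverse as well gives the divisibility back.
\<close>

lemma cont_mult_unit: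
  assumes "G * H = 1"
  shows "cont (F * G) = cont F"
proof -
  have "F * G * H = F" using assms by (simp add: mult.assoc)
  then show ?thesis
    using cont_dvd_cont_mult [of F G] cont_dvd_cont_mult [of "F * G" H, unfolded \<open>F * G * H = F\<close>]
    by (intro zdvd_antisym_nonneg cont_nonneg) auto
qed

lemma cont_W_series_diff: "cont (W_series n - W_series m) = cont (N_series n - N_series m)"
proof -
  have "D_series * fps_right_inverse D_series 1 = 1"
    by (rule fps_right_inverse) (simp add: D_series_nth_0)
  then have "cont ((W_series n - W_series m) * D_series) = cont (W_series n - W_series m)"
    by (rule cont_mult_unit)
  then show ?thesis by (simp add: left_diff_distrib W_series_mult_D_series)
qed

lemma strict_mono_tri: "strict_mono tri"
  by (rule strict_mono_Suc_iff [THEN iffD2]) (simp add: tri_Suc)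

lemma N_series_nth_tri: "N_series n $ tri k = (-1) ^ tri k * (2 * int k + 1) ^ (2 * n + 1)"
proof -
  have "{j. tri j = tri k} = {k}"
    using strict_mono_eq [OF strict_mono_tri] by auto
  then show ?thesis by (simp add: N_series_nth)
qed

lemma N_series_nth_eq_0: "i \<notin> range tri \<Longrightarrow> N_series n $ i = 0"
  by (auto simp: N_series_nth intro!: sum.neutral)

text \<open>
  The only nonzero coefficients sit at triangular numbers, one for each \<open>k\<close>, and their signs do
  not affect divisibility.
\<close>

lemma dvd_cont_N_series_diff_iff:
  "c dvd cont (N_series n - N_series m) \<longleftrightarrow>
    (\<forall>k. c dvd int (2 * k + 1) ^ (2 * n + 1) - int (2 * k + 1) ^ (2 * m + 1))"
proof -
  have "(N_series n - N_series m) $ tri k =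
      (-1) ^ tri k * (int (2 * k + 1) ^ (2 * n + 1) - int (2 * k + 1) ^ (2 * m + 1))" for k
    by (simp add: N_series_nth_tri algebra_simps)
  then have tri: "c dvd (N_series n - N_series m) $ tri k \<longleftrightarrow>
      c dvd int (2 * k + 1) ^ (2 * n + 1) - int (2 * k + 1) ^ (2 * m + 1)" for k
    by (cases "even (tri k)") (simp_all add: dvd_diff_commute)
  have "c dvd (N_series n - N_series m) $ i" if "i \<notin> range tri" for i
    using that by (simp add: N_series_nth_eq_0)
  then show ?thesis unfolding dvd_cont_iff using tri by (metis rangeE)
qed

lemma dvd_odd_power_diff_iff:
  fixes c x :: int
  assumes "a = min m n" and "int d = \<bar>int m - int n\<bar>"
  shows "c dvd x ^ (2 * n + 1) - x ^ (2 * m + 1) \<longleftrightarrow> c dvd x ^ (2 * a + 1) * (x ^ (2 * d) - 1)"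
proof (cases "m \<le> n")
  case True
  then have "a = m" "n = m + d" using assms by auto
  then show ?thesis by (simp add: algebra_simps power_add)
next
  case False
  then have "a = n" "m = n + d" using assms by auto
  then show ?thesis by (subst dvd_diff_commute) (simp add: algebra_simps power_add)
qed

section \<open>The content formula\<close>

theorem theorem6p3:
  fixes m n a d :: nat
  assumes "m \<noteq> n"
    and "a = min m n"
    and "int d = \<bar>int m - int n\<bar>"
  shows "cont (W_series n - W_series m) =
    2 ^ (3 + multiplicity 2 d) *
    (\<Prod>p | prime p \<and> odd p \<and> (p - 1) dvd 2 * d.
       int p ^ min (2 * a + 1) (1 + multiplicity p d))"
proof -
  let ?C = "cont (W_series n - W_series m)"
  let ?S = "{p. prime p \<and> odd p \<and> (p - 1) dvd 2 * d}"
  have d: "d > 0" using assms by auto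
  have dvd_C: "c dvd ?C \<longleftrightarrow>
      (\<forall>k. c dvd int (2 * k + 1) ^ (2 * a + 1) * (int (2 * k + 1) ^ (2 * d) - 1))" for c
    unfolding cont_W_series_diff dvd_cont_N_series_diff_iff
      dvd_odd_power_diff_iff [OF assms(2,3)] ..
  have mult_C: "multiplicity (int p) ?C = local_exponent a d p" if "prime p" for p
  proof (rule multiplicity_eqI)
    show "int p ^ local_exponent a d p dvd ?C"
      unfolding dvd_C using prime_power_dvd_terms [OF that d] by blast
    show "\<not> int p ^ Suc (local_exponent a d p) dvd ?C"
      unfolding dvd_C using not_prime_power_Suc_dvd_all_terms [OF that d, of a] by blast
  qed
  have "?C \<noteq> 0"
    using not_prime_power_Suc_dvd_all_terms [OF two_is_prime_nat d, of a] dvd_C [of 0]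
    by (metis dvd_0_right dvd_0_left_iff)
  then have C_pos: "?C > 0" using cont_nonneg [of "W_series n - W_series m"] by simp
  have "?S \<subseteq> {..2 * d + 1}"
    using d by (auto dest!: dvd_imp_le)
  then have fin: "finite ?S" by (rule finite_subset) simp
  \<comment> \<open>Once the factor for \<open>p = 2\<close> is absorbed, the right-hand side is a product of powers of distinct
    primes, from which multiplicities can be read off.\<close>
  let ?T = "insert 2 ?S"
  have "2 ^ (3 + multiplicity 2 d) *
      (\<Prod>p\<in>?S. int p ^ min (2 * a + 1) (1 + multiplicity p d)) =
      (\<Prod>p\<in>?T. int p ^ local_exponent a d p)"
  proof -
    have "int 2 ^ local_exponent a d 2 = 2 ^ (3 + multiplicity 2 d)"
      by (simp add: local_exponent_def)
    moreover have "(\<Prod>p\<in>?S. int p ^ min (2 * a + 1) (1 + multiplicity p d)) =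
        (\<Prod>p\<in>?S. int p ^ local_exponent a d p)"
      by (intro prod.cong refl) (auto simp: local_exponent_def)
    ultimately show ?thesis using fin by (subst prod.insert) auto
  qed
  also have "\<dots> = (\<Prod>q\<in>int ` ?T. q ^ local_exponent a d (nat q))"
    by (subst prod.reindex) auto
  also have "\<dots> = ?C"
  proof (rule multiplicity_eq_int)
    show "(\<Prod>q\<in>int ` ?T. q ^ local_exponent a d (nat q)) > 0"
      by (intro prod_pos) (auto simp: prime_gt_0_nat)
    fix q :: int assume q: "prime q"
    then obtain p where p: "q = int p" "prime p"
      by (metis prime_ge_0_int nonneg_int_cases prime_int_nat_transfer nat_int)
    have "multiplicity q (\<Prod>q\<in>int ` ?T. q ^ local_exponent a d (nat q)) =
        (if q \<in> int ` ?T then local_exponent a d (nat q) else 0)"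
      using fin q by (intro multiplicity_prod_prime_powers) auto
    also have "\<dots> = local_exponent a d p"
      using p primes_dvd_imp_eq [OF two_is_prime_nat p(2)] by (auto simp: local_exponent_def)
    also have "\<dots> = multiplicity q ?C" using mult_C p by simp
    finally show "multiplicity q (\<Prod>q\<in>int ` ?T. q ^ local_exponent a d (nat q)) = multiplicity q ?C" .
  qed (rule C_pos)
  finally show ?thesis by (rule sym)
qed

unbundle no fps_syntax

end
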